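(* Let $\mathcal X$ be a finite alphabet, let $\mathcal M$ be a finite or countable set of probability distributions on infinite sequences over $\mathcal X$, let $\mu\in\mathcal M$, and let $\xi=\sum_{\nu\in\mathcal M}w_\nu\,\nu$ with $w_\nu>0$ for all $\nu\in\mathcal M$ and $\sum_{\nu\in\mathcal M}w_\nu=1$. Let sequences $x_1x_2\ldots$ over $\mathcal X$ be drawn with probability $\mu(x_{1:n})$ for the first $n$ symbols. A system taking action (or predicting) $y_t\in\mathcal Y$ given $x_{<t}$ receives loss $\ell_{x_ty_t}\in[0,1]$ if $x_t$ is the true $t$-th symbol. Let $\Lambda_\mu$ and $\Lambda_\xi$ be the informed and mixture prediction schemes, which minimize the $\mu$-expected and the $\xi$-expected loss respectively, and let $l_t^{\Lambda_\mu}=l_t^{\Lambda_\mu}(x_{<t})$ and $l_t^{\Lambda_\xi}=l_t^{\Lambda_\xi}(x_{<t})$ be their instantaneous $\mu$-expected losses at time $t$, as defined in the context. Then, for all $n\geq 1$, all $t\ge1$, and all histories $x_{<t}$ with $\mu(x_{<t})>0$: (i) $\sum_{t=1}^n\mathbf E\big[(l_t^{\Lambda_\xi}-l_t^{\Lambda_\mu})^2\big]\le 2D_n\le 2\ln w_\mu^{-1}<\infty$; (ii) $0\le l_t^{\Lambda_\xi}-l_t^{\Lambda_\mu}\le\sum_{x_t\in\mathcal X}|\xi(x_t|x_{<t})-\mu(x_t|x_{<t})|\le\sqrt{2d_t(x_{<t})}$, and $\sqrt{2d_t(x_{<t})}\to0$ for $t\to\infty$ with $\mu$-probability 1; (iii)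 $0\le l_t^{\Lambda_\xi}-l_t^{\Lambda_\mu}\le 2d_t(x_{<t})+2\sqrt{l_t^{\Lambda_\mu}\,d_t(x_{<t})}$, and the right-hand side tends to $0$ for $t\to\infty$ with $\mu$-probability 1.
   Context: Strings: $x_{1:n}:=x_1\ldots x_n$ and $x_{<t}:=x_1\ldots x_{t-1}$. For a probability distribution $\rho$ on infinite sequences, $\rho(x_{1:t})$ is the probability that the sequence starts with $x_1\ldots x_t$, and $\rho(x_t|x_{<t}):=\rho(x_{1:t})/\rho(x_{<t})$. The mixture is $\xi(x_{1:n}):=\sum_{\nu\in\mathcal M}w_\nu\,\nu(x_{1:n})$. $\mathbf E$ denotes expectation with respect to $\mu$, and $\mathbf E_t[\cdot]:=\mathbf E[\cdot\,|\,x_{<t}]$. $\mathcal Y$ is the action (prediction) space and $\ell:\mathcal X\times\mathcal Y\to[0,1]$, $(x,y)\mapsto\ell_{xy}$, the loss function; actions do not influence the environment $\mu$. For a distribution $\rho$, the scheme $\Lambda_\rho$ chooses $$y_t^{\Lambda_\rho}:=\arg\min_{y\in\mathcal Y}\sum_{x_t\in\mathcal X}\rho(x_t|x_{<t})\,\ell_{x_ty},$$ with ties broken arbitrarily; it is assumed that a minimizer exists (automatic if $\mathcal Y$ is finite). Its instantaneous $\mu$-expected loss is $l_t^{\Lambda_\rho}(x_{<t}):=\mathbf E_t\big[\ell_{x_ty_t^{\Lambda_\rho}}\big]=\sum_{x_t\in\mathcal X}\mu(x_t|x_{<t})\,\ell_{x_ty_t^{\Lambda_\rho}}$. Relative entropy: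 $d_t(x_{<t}):=\sum_{x_t\in\mathcal X}\mu(x_t|x_{<t})\ln\frac{\mu(x_t|x_{<t})}{\xi(x_t|x_{<t})}$ (with $0\ln0:=0$) and $D_n:=\sum_{t=1}^n\mathbf E[d_t(x_{<t})]$. *)

theory Defs
  imports "HOL-Probability.Probability"
begin

text \<open>
  A string is a list. The history preceding time \<open>t\<close> is a list of length \<open>t - 1\<close>, so a function
  of the history carries its time index implicitly. Distributions enter prediction
  only through the probabilities they assign to strings, i.e. as functions \<open>p :: 'x list \<Rightarrow> real\<close>.
\<close>

definition prefix_prob :: "'x stream measure \<Rightarrow> 'x list \<Rightarrow> real" where
  "prefix_prob \<rho> xs = measure \<rho> {\<omega> \<in> space \<rho>. stake (length xs) \<omega> = xs}"

definition mixture ::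
    "'x stream measure set \<Rightarrow> ('x stream measure \<Rightarrow> real) \<Rightarrow> 'x list \<Rightarrow> real" where
  "mixture \<M> w xs = (\<Sum>\<^sub>\<infinity>\<nu>\<in>\<M>. w \<nu> * prefix_prob \<nu> xs)"

definition next_prob :: "('x list \<Rightarrow> real) \<Rightarrow> 'x list \<Rightarrow> 'x \<Rightarrow> real" where
  "next_prob p xs a = p (xs @ [a]) / p xs"

definition expected_loss ::
    "('x::finite \<Rightarrow> 'y \<Rightarrow> real) \<Rightarrow> ('x list \<Rightarrow> real) \<Rightarrow> 'x list \<Rightarrow> 'y \<Rightarrow> real" where
  "expected_loss loss p xs y = (\<Sum>a\<in>UNIV. next_prob p xs a * loss a y)"

text \<open>
  \<open>\<Lambda>\<close> maps each history to an action. The predicate admits every way of breaking ties, and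
  leaves the action free on histories of probability zero, where conditioning is meaningless.
\<close>

definition is_prediction_scheme ::
    "('x::finite \<Rightarrow> 'y \<Rightarrow> real) \<Rightarrow> ('x list \<Rightarrow> real) \<Rightarrow> ('x list \<Rightarrow> 'y) \<Rightarrow> bool" where
  "is_prediction_scheme loss p \<Lambda> \<longleftrightarrow>
     (\<forall>xs. p xs > 0 \<longrightarrow> is_arg_min (expected_loss loss p xs) (\<lambda>y. True) (\<Lambda> xs))"

definition inst_loss ::
    "('x::finite \<Rightarrow> 'y \<Rightarrow> real) \<Rightarrow> 'x stream measure \<Rightarrow> ('x list \<Rightarrow> 'y) \<Rightarrow> 'x list \<Rightarrow> real" where
  "inst_loss loss \<mu> \<Lambda> xs = expected_loss loss (prefix_prob \<mu>) xs (\<Lambda> xs)"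

text \<open>
  The convention \<open>0 ln 0 = 0\<close> holds automatically, since \<open>ln\<close> and division are total. The value is
  the relative entropy only if \<open>q\<close> vanishes nowhere that \<open>p\<close> does not; this holds
  for \<open>q\<close> a mixture that gives \<open>p\<close> positive weight.
\<close>

definition rel_entropy :: "('x::finite list \<Rightarrow> real) \<Rightarrow> ('x list \<Rightarrow> real) \<Rightarrow> 'x list \<Rightarrow> real" where
  "rel_entropy p q xs =
     (\<Sum>a\<in>UNIV. next_prob p xs a * ln (next_prob p xs a / next_prob q xs a))"

definition total_rel_entropy ::
    "'x::finite stream measure \<Rightarrow> ('x list \<Rightarrow> real) \<Rightarrow> nat \<Rightarrow> real" where
  "total_rel_entropy \<mu> q n =
     (\<Sum>t=1..n. \<integral>\<omega>. rel_entropy (prefix_prob \<mu>) q (stake (t - 1) \<omega>) \<partial>\<mu>)"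

end

theory Submission
  imports Defs
begin

text \<open>
  Write \<open>P\<close>, \<open>Q\<close> for expectations of a loss under the next-symbol distributions \<open>p\<close> of \<open>\<mu>\<close> and \<open>q\<close> of
  \<open>\<xi>\<close>, and \<open>m\<close>, \<open>s\<close> for the losses of \<open>\<Lambda>\<^sub>\<xi>\<close>, \<open>\<Lambda>\<^sub>\<mu>\<close>; the only fact about \<open>\<Lambda>\<^sub>\<xi>\<close> needed is \<open>Q m \<le> Q s\<close>.
  Hence \<open>P m - P s \<le> \<Sum>\<bar>p - q\<bar>\<close>, and Pinsker's inequality follows by Cauchy--Schwarz with weights
  \<open>p + 2 q\<close> from \<open>3 (t - 1)\<^sup>2 / (2 (t + 2)) \<le> t ln t - t + 1\<close>. For the bound with
  \<open>\<surd>(l d)\<close> one shows \<open>P m \<le> (1 + A) P s + (2 + 1/A) d\<close> for every \<open>A > 0\<close>: with a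
  Lagrange multiplier for \<open>Q m \<le> Q s\<close> this holds symbol by symbol. Then one optimises over \<open>A\<close>.

  By the chain rule, \<open>D\<^sub>n\<close> is the expectation of \<open>ln (\<mu>(x) / \<xi>(x))\<close> over strings \<open>x\<close> of length \<open>n\<close>, which the
  dominance \<open>\<xi> \<ge> w\<^sub>\<mu> \<mu>\<close> bounds by \<open>ln (1 / w\<^sub>\<mu>)\<close>. So \<open>\<Sum> d\<^sub>t\<close> has finite expectation and \<open>d\<^sub>t\<close>
  tends to \<open>0\<close> almost surely.
\<close>

subsection \<open>Inequalities for relative entropy\<close>

text \<open>The left side is the tangent line, taken at \<open>p = q * exp c\<close>, of the convex
  function \<open>p * ln (p / q)\<close> of \<open>p\<close>. The free parameter \<open>c\<close> is
  later set to 0, to \<open>1 / B\<close> and to \<open>- (1 + A) / B\<close>.\<close>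

lemma mult_ln_quotient_ge:
  fixes p q c :: real
  assumes "0 \<le> p" "0 \<le> q" "p > 0 \<Longrightarrow> q > 0"
  shows "(1 + c) * p - q * exp c \<le> p * ln (p / q)"
proof (cases "p = 0")
  case False
  then have pos: "p > 0" "q > 0" using assms by auto
  have "ln (q * exp c / p) \<le> q * exp c / p - 1"
    using pos by (intro ln_le_minus_one) simp
  then have "c - ln (p / q) \<le> q * exp c / p - 1"
    using pos by (simp add: ln_div ln_mult)
  then have "p * (c - ln (p / q)) \<le> p * (q * exp c / p - 1)"
    using pos by (intro mult_left_mono) auto
  then show ?thesis using pos by (simp add: algebra_simps)
qed (use assms in simp)

text \<open>The difference of the two sides is convex and its tangent at 1 is zero. The factor
  \<open>3 / (2 * (t + 2))\<close> makes the two sides agree at 1 up to the third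
  derivative.\<close>

lemma ln_pinsker_bound:
  fixes t :: real
  assumes "t > 0"
  shows "3 * (t - 1)\<^sup>2 / (2 * (t + 2)) \<le> t * ln t - t + 1"
proof -
  define f where "f t = t * ln t - t + 1 - 3 * (t - 1)\<^sup>2 / (2 * (t + 2))" for t :: real
  define f' where "f' t = ln t - 3 * (t - 1) * (t + 5) / (2 * (t + 2)\<^sup>2)" for t :: real
  define f'' where "f'' t = 1 / t - 27 / (t + 2) ^ 3" for t :: real
  have deriv_f: "(f has_real_derivative f' x) (at x)" if x: "x > 0" for x
    unfolding f_def f'_def using x
    apply (auto intro!: derivative_eq_intros)
    apply (simp add: divide_simps)
    apply (simp add: algebra_simps power2_eq_square power4_eq_xxxx)
    done
  have "convex_on {0<..} f"
  proof (rule f''_ge0_imp_convex)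
    fix x :: real assume "x \<in> {0<..}"
    then have x: "x > 0" by simp
    show "(f has_real_derivative f' x) (at x)" by (rule deriv_f[OF x])
    show "(f' has_real_derivative f'' x) (at x)"
      unfolding f'_def f''_def using x
      apply (auto intro!: derivative_eq_intros)
      apply (simp add: divide_simps)
      apply (simp add: algebra_simps power2_eq_square power3_eq_cube power4_eq_xxxx)
      done
    \<comment> \<open>This product equals \<open>(x + 2) ^ 3 - 27 * x\<close>, the numerator of
      \<open>f'' x\<close>.\<close>
    have "0 \<le> (x - 1)\<^sup>2 * (x + 8)" using x by simp
    then have "27 * x \<le> (x + 2) ^ 3"
      by (simp add: power2_eq_square power3_eq_cube algebra_simps)
    then show "f'' x \<ge> 0"
      unfolding f''_def using x by (simp add: divide_simps)
  qed simp
  then have "f t - f 1 \<ge> f' 1 * (t - 1)"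
    by (rule convex_on_imp_above_tangent)
      (use assms has_field_derivative_at_within[OF deriv_f[of 1]] in \<open>auto simp: interior_open\<close>)
  then show ?thesis by (simp add: f_def f'_def)
qed

text \<open>For \<open>u < 2\<close> this is the Pade bound \<open>(2 + u) / (2 - u)\<close> on
  \<open>exp u\<close>. Moving \<open>u\<close> to the left gives a function with derivative
  \<open>(1 - x) * exp x - 1\<close>, nonpositive because
  \<open>1 - x \<le> exp (- x)\<close>.\<close>

lemma exp_le_pade:
  fixes u :: real
  assumes "0 \<le> u"
  shows "(2 - u) * exp u \<le> 2 + u"
proof -
  define f where "f u = (2 - u) * exp u - u" for u :: real
  have "f u \<le> f 0"
  proof (rule DERIV_nonpos_imp_nonincreasing[OF assms])
    fix x :: real
    have "(f has_real_derivative (1 - x) * exp x - 1) (at x)"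
      unfolding f_def by (auto intro!: derivative_eq_intros simp: algebra_simps)
    moreover have "(1 - x) * exp x \<le> exp (- x) * exp x"
      using exp_ge_add_one_self[of "- x"] by (intro mult_right_mono) auto
    ultimately show "\<exists>y. (f has_real_derivative y) (at x) \<and> y \<le> 0"
      by (auto simp flip: exp_add)
  qed
  then show ?thesis by (simp add: f_def)
qed

text \<open>The exponentials are replaced by rational bounds that add up to exactly 2: the Pade
  bound \<open>(2 + u) / (2 - u)\<close> and \<open>(2 - 3 * u) / (2 - u)\<close>. The reciprocal of
  the second lies below the quadratic Taylor bound for \<open>exp v\<close>.\<close>

lemma exp_plus_exp_minus_le_2:
  fixes u :: real
  assumes u: "0 < u" "u < 1 / 2"
  shows "exp u + exp (- (u * (1 - u) / (1 - 2 * u))) \<le> 2"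
proof -
  define v where "v = u * (1 - u) / (1 - 2 * u)"
  have v: "v \<ge> 0" using u by (simp add: v_def)
  have pos: "0 < 2 - 3 * u" "0 < 2 - u" "0 < 1 - 2 * u" using u by auto
  have "u * u \<le> u * (1 / 2)" "u * u \<le> 1 / 2 * (1 / 2)"
    using u by (intro mult_mono; simp)+
  then have poly: "0 \<le> u ^ 3 * (3 - 4 * u - 3 * u\<^sup>2)"
    using u by (simp add: power2_eq_square)
  have "(1 + v + v\<^sup>2 / 2) - (2 - u) / (2 - 3 * u)
      = u ^ 3 * (3 - 4 * u - 3 * u\<^sup>2) / (2 * (1 - 2 * u)\<^sup>2 * (2 - 3 * u))"
    using pos unfolding v_def by (simp add: divide_simps) algebra
  also have "\<dots> \<ge> 0"
    using poly pos by (intro divide_nonneg_pos) auto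
  finally have "(2 - u) / (2 - 3 * u) \<le> 1 + v + v\<^sup>2 / 2" by simp
  also have "\<dots> \<le> exp v" using exp_lower_Taylor_quadratic[OF v] by simp
  finally have "inverse (exp v) \<le> inverse ((2 - u) / (2 - 3 * u))"
    using pos by (intro le_imp_inverse_le) auto
  then have "exp (- v) \<le> (2 - 3 * u) / (2 - u)"
    by (simp add: exp_minus)
  moreover have "exp u \<le> (2 + u) / (2 - u)"
    using exp_le_pade[of u] u by (simp add: field_simps)
  ultimately have "exp u + exp (- v) \<le> (2 + u) / (2 - u) + (2 - 3 * u) / (2 - u)" by simp
  also have "\<dots> = 2" using pos by (simp add: divide_simps)
  finally show ?thesis by (simp add: v_def)
qed

text \<open>
  The right-hand side minus the left is linear in \<open>m\<close> and in \<open>s\<close>, so it suffices to look at the corners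
  of the unit square. The multiplier \<open>c\<close> is the least one for which the corner \<open>m = 1, s = 0\<close> is fine;
  the corner \<open>m = 0, s = 1\<close> then amounts to \<open>exp_plus_exp_minus_le_2\<close> at \<open>u = 1/B\<close>.
\<close>

lemma loss_gap_termwise:
  fixes p q m s A :: real
  assumes pq: "0 \<le> p" "0 \<le> q" "p > 0 \<Longrightarrow> q > 0"
    and ms: "m \<in> {0..1}" "s \<in> {0..1}" and A: "A > 0"
  defines "B \<equiv> 2 + 1 / A"
  defines "c \<equiv> B * (exp (1 / B) - 1)"
  shows "p * m \<le> (1 + A) * (p * s) + B * (p * ln (p / q) - p + q) + c * (q * m - q * s)"
proof -
  have B: "B > 2" using A by (simp add: B_def)
  have u: "0 < 1 / B" "1 / B < 1 / 2" using B by auto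
  \<comment> \<open>With \<open>B = 2 + 1 / A\<close> the second exponent becomes
    \<open>(1 + A) / B\<close>, the one that produces the coefficient \<open>1 + A\<close> in
    \<open>K2\<close>.\<close>
  have "1 / B * (1 - 1 / B) / (1 - 2 * (1 / B)) = (1 + A) / B"
    using A unfolding B_def by (simp add: divide_simps)
  with exp_plus_exp_minus_le_2[OF u]
  have key: "exp (1 / B) - 1 \<le> 1 - exp (- ((1 + A) / B))" by simp
  define K where "K = B * (p * ln (p / q) - p + q)"
  have K0: "0 \<le> K"
    using mult_ln_quotient_ge[OF pq, of 0] B by (simp add: K_def)
  have K1: "p - c * q \<le> K"
  proof -
    have "B * ((1 + 1 / B) * p - q * exp (1 / B)) \<le> B * (p * ln (p / q))"
      using B by (intro mult_left_mono mult_ln_quotient_ge pq) auto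
    then show ?thesis using B by (simp add: K_def c_def algebra_simps)
  qed
  have K2: "c * q - (1 + A) * p \<le> K"
  proof -
    define v where "v = (1 + A) / B"
    have v: "B * v = 1 + A" using B by (simp add: v_def)
    have "B * ((1 + - v) * p - q * exp (- v)) \<le> B * (p * ln (p / q))"
      using B by (intro mult_left_mono mult_ln_quotient_ge pq) auto
    moreover have "B * ((1 + - v) * p - q * exp (- v)) = B * p - (B * v) * p - B * (q * exp (- v))"
      by (simp add: algebra_simps)
    moreover have "B * q * (exp (1 / B) - 1) \<le> B * q * (1 - exp (- v))"
      using B pq key by (intro mult_left_mono) (auto simp: v_def)
    ultimately show ?thesis unfolding v by (simp add: K_def c_def algebra_simps)
  qed
  \<comment> \<open>The coefficients of \<open>m\<close> and \<open>s\<close> add up to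
    \<open>- A * p\<close>, so they are never both positive. A positive one is bounded by
    \<open>K1\<close> or \<open>K2\<close>; if there is none, \<open>K0\<close> suffices.\<close>
  have "(p - c * q) * m + (c * q - (1 + A) * p) * s \<le> K"
  proof (cases "c * q \<le> p")
    case True
    have "0 \<le> A * p" using A pq by simp
    then have "(c * q - (1 + A) * p) * s \<le> 0"
      using True ms by (intro mult_nonpos_nonneg) (auto simp: algebra_simps)
    moreover have "(p - c * q) * m \<le> p - c * q"
      using True ms by (intro mult_left_le) auto
    ultimately show ?thesis using K1 by linarith
  next
    case False
    then have "(p - c * q) * m \<le> 0"
      using ms by (intro mult_nonpos_nonneg) auto
    moreover have "(c * q - (1 + A) * p) * s \<le> K"
    proof (cases "c * q \<le> (1 + A) * p")
      case True
      then have "(c * q - (1 + A) * p) * s \<le> 0"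
        using ms by (intro mult_nonpos_nonneg) auto
      with K0 show ?thesis by linarith
    next
      case False
      then have "(c * q - (1 + A) * p) * s \<le> c * q - (1 + A) * p"
        using ms by (intro mult_left_le) auto
      with K2 show ?thesis by linarith
    qed
    ultimately show ?thesis by linarith
  qed
  then show ?thesis by (simp add: K_def algebra_simps)
qed

lemma le_two_sqrt_of_weighted:
  fixes x S d :: real
  assumes S: "0 \<le> S" and d: "0 \<le> d" and le: "\<And>A. A > 0 \<Longrightarrow> x \<le> A * S + d / A"
  shows "x \<le> 2 * sqrt (S * d)"
proof (rule tendsto_lowerbound)
  show "((\<lambda>e. 2 * sqrt ((S + e) * (d + e))) \<longlongrightarrow> 2 * sqrt (S * d)) (at_right 0)"
    by (auto intro!: tendsto_eq_intros)
  show "\<forall>\<^sub>F e in at_right 0. x \<le> 2 * sqrt ((S + e) * (d + e))"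
    unfolding eventually_at_right_field
  proof (intro exI[of _ 1] conjI allI impI)
    fix e :: real assume e: "0 < e"
    define A where "A = sqrt (d + e) / sqrt (S + e)"
    have pos: "sqrt (S + e) > 0" "sqrt (d + e) > 0" using S d e by auto
    then have A: "A > 0" by (simp add: A_def)
    have "x \<le> A * S + d / A" by (rule le[OF A])
    also have "\<dots> \<le> A * (S + e) + (d + e) / A"
      using A e by (intro add_mono mult_left_mono divide_right_mono) auto
    also have "\<dots> = A * (sqrt (S + e))\<^sup>2 + (sqrt (d + e))\<^sup>2 / A"
      using S d e by simp
    also have "\<dots> = 2 * (sqrt (S + e) * sqrt (d + e))"
      using pos unfolding A_def by (simp add: power2_eq_square del: real_sqrt_mult_self real_sqrt_gt_0_iff)
    finally show "x \<le> 2 * sqrt ((S + e) * (d + e))" by (simp add: real_sqrt_mult)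
  qed simp
qed simp

section \<open>Pinsker's inequality and loss gaps for two probability vectors\<close>

context
  fixes I :: "'a set" and p q :: "'a \<Rightarrow> real"
  assumes p: "\<And>i. i \<in> I \<Longrightarrow> 0 \<le> p i" and q: "\<And>i. i \<in> I \<Longrightarrow> 0 \<le> q i"
    and ac: "\<And>i. i \<in> I \<Longrightarrow> p i > 0 \<Longrightarrow> q i > 0"
    and sum_p: "sum p I = 1" and sum_q: "sum q I = 1"
begin

text \<open>The added terms cancel in total but make every summand nonnegative, so that bounds can
  be proved symbol by symbol.\<close>

lemma sum_mult_ln_eq:
  "(\<Sum>i\<in>I. p i * ln (p i / q i)) = (\<Sum>i\<in>I. p i * ln (p i / q i) - p i + q i)"
  by (simp add: sum.distrib sum_subtractf sum_p sum_q)

lemma Gibbs_inequality: "0 \<le> (\<Sum>i\<in>I. p i * ln (p i / q i))"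
  unfolding sum_mult_ln_eq
  proof (rule sum_nonneg)
  fix i assume i: "i \<in> I"
  show "0 \<le> p i * ln (p i / q i) - p i + q i"
    using mult_ln_quotient_ge[OF p[OF i] q[OF i] ac[OF i], of 0] by simp
qed

lemma Pinsker_inequality:
  "(\<Sum>i\<in>I. \<bar>q i - p i\<bar>) \<le> sqrt (2 * (\<Sum>i\<in>I. p i * ln (p i / q i)))"
proof -
  have summand: "3 * (p i - q i)\<^sup>2 / (2 * (p i + 2 * q i)) \<le> p i * ln (p i / q i) - p i + q i"
    if i: "i \<in> I" for i
  proof (cases "p i = 0")
    case True
    with q[OF i] show ?thesis by (simp add: divide_simps power2_eq_square)
  next
    case False
    then have pos: "p i > 0" "q i > 0" using p[OF i] ac[OF i] by auto
    \<comment> \<open>This is \<open>ln_pinsker_bound\<close> at \<open>t = p i / q i\<close>,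
      multiplied by \<open>q i\<close>.\<close>
    have "q i * (3 * (p i / q i - 1)\<^sup>2 / (2 * (p i / q i + 2)))
        \<le> q i * (p i / q i * ln (p i / q i) - p i / q i + 1)"
      using pos by (intro mult_left_mono ln_pinsker_bound) auto
    moreover have "q i * (3 * (p i / q i - 1)\<^sup>2 / (2 * (p i / q i + 2)))
        = 3 * (p i - q i)\<^sup>2 / (2 * (p i + 2 * q i))"
      using pos by (simp add: divide_simps) (simp add: power2_eq_square algebra_simps)
    ultimately show ?thesis using pos by (simp add: algebra_simps)
  qed
  have "(\<Sum>i\<in>I. \<bar>q i - p i\<bar>)\<^sup>2
      = (\<Sum>i\<in>I. (\<bar>q i - p i\<bar> / sqrt (p i + 2 * q i)) * sqrt (p i + 2 * q i))\<^sup>2"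
  proof (intro arg_cong[where f = "\<lambda>x. x\<^sup>2"] sum.cong refl)
    fix i assume i: "i \<in> I"
    show "\<bar>q i - p i\<bar> = \<bar>q i - p i\<bar> / sqrt (p i + 2 * q i) * sqrt (p i + 2 * q i)"
      using p[OF i] q[OF i] by (cases "p i + 2 * q i = 0") auto
  qed
  also have "\<dots> \<le> (\<Sum>i\<in>I. (\<bar>q i - p i\<bar> / sqrt (p i + 2 * q i))\<^sup>2) * (\<Sum>i\<in>I. (sqrt (p i + 2 * q i))\<^sup>2)"
    by (rule Cauchy_Schwarz_ineq_sum)
  also have "(\<Sum>i\<in>I. (sqrt (p i + 2 * q i))\<^sup>2) = (\<Sum>i\<in>I. p i + 2 * q i)"
    using p q by (intro sum.cong refl real_sqrt_pow2) auto
  \<comment> \<open>The total weight 3 matches the factor 3 of \<open>ln_pinsker_bound\<close>,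
    which leaves Pinsker's constant 2.\<close>
  also have "\<dots> = 3"
    by (simp add: sum.distrib sum_p sum_q flip: sum_distrib_left)
  also have "(\<Sum>i\<in>I. (\<bar>q i - p i\<bar> / sqrt (p i + 2 * q i))\<^sup>2) * 3
      = 2 * (\<Sum>i\<in>I. 3 * (p i - q i)\<^sup>2 / (2 * (p i + 2 * q i)))"
    unfolding sum_distrib_left sum_distrib_right
  proof (intro sum.cong refl)
    fix i assume i: "i \<in> I"
    have "x / b * 3 = 2 * (3 * x / (2 * b))" for x b :: real by simp
    then show "(\<bar>q i - p i\<bar> / sqrt (p i + 2 * q i))\<^sup>2 * 3
        = 2 * (3 * (p i - q i)\<^sup>2 / (2 * (p i + 2 * q i)))"
      using p[OF i] q[OF i] by (simp add: power_divide power2_commute[of "q i"] del: distrib_left_numeral)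
  qed
  also have "\<dots> \<le> 2 * (\<Sum>i\<in>I. p i * ln (p i / q i))"
    unfolding sum_mult_ln_eq by (intro mult_left_mono sum_mono summand) auto
  finally show ?thesis by (rule real_le_rsqrt)
qed

text \<open>Summing \<open>loss_gap_termwise\<close> leaves a multiplier term that is nonpositive by
  \<open>le\<close>. The 2 in \<open>B = 2 + 1 / A\<close> gives the linear entropy term; balancing
  \<open>1 / A\<close> against \<open>A\<close> gives the square root.\<close>

lemma loss_gap_bound:
  assumes m: "\<And>i. i \<in> I \<Longrightarrow> m i \<in> {0..1}" and s: "\<And>i. i \<in> I \<Longrightarrow> s i \<in> {0..1}"
    and le: "(\<Sum>i\<in>I. q i * m i) \<le> (\<Sum>i\<in>I. q i * s i)"
  shows "(\<Sum>i\<in>I. p i * m i) - (\<Sum>i\<in>I. p i * s i)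
      \<le> 2 * (\<Sum>i\<in>I. p i * ln (p i / q i))
        + 2 * sqrt ((\<Sum>i\<in>I. p i * s i) * (\<Sum>i\<in>I. p i * ln (p i / q i)))"
proof -
  define S d where "S = (\<Sum>i\<in>I. p i * s i)" and "d = (\<Sum>i\<in>I. p i * ln (p i / q i))"
  have "(\<Sum>i\<in>I. p i * m i) - S - 2 * d \<le> 2 * sqrt (S * d)"
  proof (rule le_two_sqrt_of_weighted)
    show "0 \<le> S" unfolding S_def using p s by (intro sum_nonneg) auto
    show "0 \<le> d" unfolding d_def by (rule Gibbs_inequality)
    fix A :: real assume A: "A > 0"
    define B where "B = 2 + 1 / A"
    define c where "c = B * (exp (1 / B) - 1)"
    have c: "0 \<le> c" using A by (simp add: c_def B_def)
    have "(\<Sum>i\<in>I. p i * m i)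
        \<le> (\<Sum>i\<in>I. (1 + A) * (p i * s i) + B * (p i * ln (p i / q i) - p i + q i)
                  + c * (q i * m i - q i * s i))"
      unfolding B_def c_def
      by (intro sum_mono loss_gap_termwise p q ac m s A)
    also have "\<dots> = (1 + A) * S + B * d + c * ((\<Sum>i\<in>I. q i * m i) - (\<Sum>i\<in>I. q i * s i))"
      unfolding S_def d_def sum_mult_ln_eq
      by (simp only: sum.distrib sum_subtractf flip: sum_distrib_left)
    also have "\<dots> \<le> (1 + A) * S + B * d"
      using c le by (simp add: mult_nonneg_nonpos)
    finally show "(\<Sum>i\<in>I. p i * m i) - S - 2 * d \<le> A * S + d / A"
      by (simp add: B_def algebra_simps)
  qed
  then show ?thesis by (simp add: S_def d_def)
qed

text \<open>Adding the nonnegative gap under \<open>q\<close> turns the left side into a sum of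
  \<open>(q i - p i) * (s i - m i)\<close>, where the second factor is at most 1 in absolute
  value.\<close>

lemma loss_gap_le_total_variation:
  assumes m: "\<And>i. i \<in> I \<Longrightarrow> m i \<in> {0..1}" and s: "\<And>i. i \<in> I \<Longrightarrow> s i \<in> {0..1}"
    and le: "(\<Sum>i\<in>I. q i * m i) \<le> (\<Sum>i\<in>I. q i * s i)"
  shows "(\<Sum>i\<in>I. p i * m i) - (\<Sum>i\<in>I. p i * s i) \<le> (\<Sum>i\<in>I. \<bar>q i - p i\<bar>)"
proof -
  have "(\<Sum>i\<in>I. p i * m i) - (\<Sum>i\<in>I. p i * s i)
      \<le> (\<Sum>i\<in>I. p i * m i) - (\<Sum>i\<in>I. p i * s i)
        + ((\<Sum>i\<in>I. q i * s i) - (\<Sum>i\<in>I. q i * m i))"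
    using le by simp
  also have "\<dots> = (\<Sum>i\<in>I. (q i - p i) * (s i - m i))"
    by (simp add: sum.distrib sum_subtractf algebra_simps)
  also have "\<dots> \<le> (\<Sum>i\<in>I. \<bar>q i - p i\<bar>)"
  proof (rule sum_mono)
    fix i assume i: "i \<in> I"
    have "\<bar>q i - p i\<bar> * \<bar>s i - m i\<bar> \<le> \<bar>q i - p i\<bar> * 1"
      using m[OF i] s[OF i] by (intro mult_left_mono) auto
    then show "(q i - p i) * (s i - m i) \<le> \<bar>q i - p i\<bar>"
      by (metis abs_ge_self abs_mult mult.right_neutral order_trans)
  qed
  finally show ?thesis .
qed

end

subsection \<open>Distributions on strings and sequences\<close>

text \<open>These are Kolmogorov's consistency conditions for cylinder probabilities. They treat
  measures and mixtures alike, without constructing a measure for the mixture.\<close>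

definition string_distribution :: "('x::finite list \<Rightarrow> real) \<Rightarrow> bool" where
  "string_distribution p \<longleftrightarrow>
     p [] = 1 \<and> (\<forall>xs. 0 \<le> p xs) \<and> (\<forall>xs. (\<Sum>a\<in>UNIV. p (xs @ [a])) = p xs)"

lemma string_distribution_snoc_eq_0:
  assumes "string_distribution p" "p xs = 0"
  shows "p (xs @ [a]) = 0"
  using assms sum_nonneg_eq_0_iff[of UNIV "\<lambda>a. p (xs @ [a])"]
  by (simp add: string_distribution_def)

lemma next_prob_nonneg:
  "string_distribution p \<Longrightarrow> 0 \<le> next_prob p xs a"
  by (simp add: string_distribution_def next_prob_def)

lemma sum_next_prob:
  "string_distribution p \<Longrightarrow> p xs > 0 \<Longrightarrow> (\<Sum>a\<in>UNIV. next_prob p xs a) = 1"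
  by (simp add: string_distribution_def next_prob_def flip: sum_divide_distrib)

lemma sum_lists_Suc:
  "(\<Sum>xs | length xs = Suc n. f xs) = (\<Sum>xs | length xs = n. \<Sum>a\<in>UNIV. f (xs @ [a]))"
  for f :: "'x::finite list \<Rightarrow> real"
proof -
  have "(\<Sum>xs | length xs = n. \<Sum>a\<in>UNIV. f (xs @ [a]))
      = (\<Sum>(xs, a)\<in>{xs. length xs = n} \<times> UNIV. f (xs @ [a]))"
    by (rule sum.cartesian_product)
  also have "\<dots> = (\<Sum>xs | length xs = Suc n. f xs)"
    by (rule sum.reindex_bij_witness[of _ "\<lambda>xs. (butlast xs, last xs)" "\<lambda>(xs, a). xs @ [a]"])
      (auto simp: append_butlast_last_id simp flip: length_0_conv)
  finally show ?thesis by simp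
qed

lemma finite_lists_of_length: "finite {xs :: 'x::finite list. length xs = n}"
  using finite_lists_length_eq[of "UNIV :: 'x set" n] by simp

lemma sum_string_distribution:
  assumes "string_distribution p"
  shows "(\<Sum>xs | length xs = n. p xs) = 1"
proof (induction n)
  case (Suc n)
  with assms show ?case by (simp add: sum_lists_Suc string_distribution_def)
qed (use assms in \<open>simp add: string_distribution_def\<close>)

text \<open>The log ratio of a string is that of its prefix plus that of its last conditional
  probability. Summing over the last symbol restores the weight \<open>p xs\<close> of the
  prefix.\<close>

lemma rel_entropy_chain_rule:
  assumes p: "string_distribution p" and q: "string_distribution q"
    and ac: "\<And>xs. p xs > 0 \<Longrightarrow> q xs > 0"
  shows "(\<Sum>t<n. \<Sum>xs | length xs = t. p xs * rel_entropy p q xs)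
      = (\<Sum>xs | length xs = n. p xs * ln (p xs / q xs))"
proof (induction n)
  case 0
  show ?case using p q by (simp add: string_distribution_def)
next
  case (Suc n)
  have "(\<Sum>a\<in>UNIV. p (xs @ [a]) * ln (p (xs @ [a]) / q (xs @ [a])))
      = p xs * ln (p xs / q xs) + p xs * rel_entropy p q xs" for xs
  \<comment> \<open>On a null history \<open>rel_entropy\<close> is meaningless, but its weight is 0
    and so are the probabilities of all extensions.\<close>
  proof (cases "p xs = 0")
    case True
    then show ?thesis by (simp add: string_distribution_snoc_eq_0[OF p])
  next
    case False
    then have xs: "p xs > 0" using p by (simp add: string_distribution_def less_le)
    note qxs = ac[OF xs]
    have "p (xs @ [a]) * ln (p (xs @ [a]) / q (xs @ [a]))
        = p (xs @ [a]) * ln (p xs / q xs)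
          + p xs * (next_prob p xs a * ln (next_prob p xs a / next_prob q xs a))" for a
    proof (cases "p (xs @ [a]) = 0")
      case False
      then have a: "p (xs @ [a]) > 0" using p by (simp add: string_distribution_def less_le)
      show ?thesis
        using xs qxs a ac[OF a] by (simp add: next_prob_def ln_div ln_mult algebra_simps)
    qed (simp add: next_prob_def)
    then have "(\<Sum>a\<in>UNIV. p (xs @ [a]) * ln (p (xs @ [a]) / q (xs @ [a])))
        = (\<Sum>a\<in>UNIV. p (xs @ [a])) * ln (p xs / q xs) + p xs * rel_entropy p q xs"
      by (simp add: sum.distrib rel_entropy_def sum_distrib_left sum_distrib_right)
    then show ?thesis using p by (simp add: string_distribution_def)
  qed
  then show ?case using Suc by (simp add: sum_lists_Suc sum.distrib)
qed

text \<open>The chain rule leaves one log ratio per string, which dominance bounds by a constant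
  independent of \<open>n\<close>.\<close>

lemma sum_rel_entropy_le:
  assumes p: "string_distribution p" and q: "string_distribution q"
    and c: "c > 0" and le: "\<And>xs. c * p xs \<le> q xs"
  shows "(\<Sum>t<n. \<Sum>xs | length xs = t. p xs * rel_entropy p q xs) \<le> ln (inverse c)"
proof -
  have p0: "0 \<le> p xs" for xs using p by (simp add: string_distribution_def)
  have ac: "q xs > 0" if "p xs > 0" for xs
    using le[of xs] mult_pos_pos[OF c that] by linarith
  have "p xs * ln (p xs / q xs) \<le> p xs * ln (inverse c)" for xs
  proof (cases "p xs = 0")
    case False
    then have xs: "p xs > 0" using p0[of xs] by simp
    have "p xs / q xs \<le> inverse c"
      using le[of xs] ac[OF xs] c by (simp add: field_simps)
    then show ?thesis
      using xs ac[OF xs] c by (intro mult_left_mono) auto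
  qed simp
  then have "(\<Sum>xs | length xs = n. p xs * ln (p xs / q xs))
      \<le> (\<Sum>xs | length xs = n. p xs * ln (inverse c))"
    by (rule sum_mono)
  also have "\<dots> = ln (inverse c)"
    by (simp add: sum_string_distribution[OF p] flip: sum_distrib_right)
  finally show ?thesis by (simp add: rel_entropy_chain_rule[OF p q ac])
qed

text \<open>By monotone convergence the series has finite integral, so it converges almost surely
  and its terms tend to 0. Working in \<open>ennreal\<close> makes the exchange of sum and integral
  unconditional.\<close>

lemma AE_tendsto_0_if_sum_integral_bounded:
  fixes f :: "nat \<Rightarrow> 'a \<Rightarrow> real"
  assumes int: "\<And>n. integrable M (f n)" and nonneg: "\<And>n. AE x in M. 0 \<le> f n x"
    and bound: "\<And>n. (\<Sum>k<n. \<integral>x. f k x \<partial>M) \<le> C"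
  shows "AE x in M. (\<lambda>n. f n x) \<longlonglongrightarrow> 0"
proof -
  have [measurable]: "f n \<in> borel_measurable M" for n
    using int by (rule borel_measurable_integrable)
  have integral_nonneg: "0 \<le> (\<integral>x. f n x \<partial>M)" for n
    by (rule integral_nonneg_AE[OF nonneg])
  have "(\<integral>\<^sup>+x. (\<Sum>n. ennreal (f n x)) \<partial>M) = (\<Sum>n. \<integral>\<^sup>+x. ennreal (f n x) \<partial>M)"
    by (rule nn_integral_suminf) measurable
  also have "\<dots> = (\<Sum>n. ennreal (\<integral>x. f n x \<partial>M))"
    by (intro suminf_cong nn_integral_eq_integral int nonneg)
  also have "\<dots> \<le> ennreal C"
    by (intro suminf_le_const summableI)
      (simp add: sum_ennreal integral_nonneg ennreal_leI bound)
  finally have "(\<integral>\<^sup>+x. (\<Sum>n. ennreal (f n x)) \<partial>M) \<noteq> \<infinity>"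
    by (auto simp: top_unique)
  then have "AE x in M. (\<Sum>n. ennreal (f n x)) \<noteq> \<infinity>"
    by (intro nn_integral_noteq_infinite) auto
  moreover have "AE x in M. \<forall>n. 0 \<le> f n x" using nonneg by (simp add: AE_all_countable)
  ultimately show ?thesis
  proof eventually_elim
    case (elim x)
    then have "summable (\<lambda>n. f n x)" by (intro summable_suminf_not_top) auto
    then show ?case by (rule summable_LIMSEQ_zero)
  qed
qed

section \<open>Prefix probabilities and expectations of functions of a prefix\<close>

context
  fixes \<rho> :: "'x::finite stream measure"
  assumes prob: "prob_space \<rho>" and sets: "sets \<rho> = sets (stream_space (count_space UNIV))"
begin

interpretation prob_space \<rho> by (rule prob)

lemma measurable_stake_sequence [measurable]: "stake n \<in> measurable \<rho> (count_space UNIV)"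
  using measurable_stake[of n] measurable_cong_sets[OF sets refl] by blast

lemma prefix_event [measurable]: "{\<omega> \<in> space \<rho>. stake n \<omega> = xs} \<in> sets \<rho>"
  by measurable

lemma string_distribution_prefix_prob: "string_distribution (prefix_prob \<rho>)"
proof -
  have "(\<Sum>a\<in>UNIV. prefix_prob \<rho> (xs @ [a])) = prefix_prob \<rho> xs" for xs
  proof -
    have "(\<Sum>a\<in>UNIV. prefix_prob \<rho> (xs @ [a]))
        = measure \<rho> (\<Union>a. {\<omega> \<in> space \<rho>. stake (length (xs @ [a])) \<omega> = xs @ [a]})"
      unfolding prefix_prob_def
      by (rule finite_measure_finite_Union[symmetric])
        (auto simp: disjoint_family_on_def simp del: stake.simps)
    also have "(\<Union>a. {\<omega> \<in> space \<rho>. stake (length (xs @ [a])) \<omega> = xs @ [a]})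
        = {\<omega> \<in> space \<rho>. stake (length xs) \<omega> = xs}"
      by (auto simp: stake_Suc simp del: stake.simps)
    finally show ?thesis by (simp add: prefix_prob_def)
  qed
  then show ?thesis
    by (simp add: string_distribution_def) (simp add: prefix_prob_def prob_space)
qed

lemma prefix_prob_le_1: "prefix_prob \<rho> xs \<le> 1"
  by (simp add: prefix_prob_def)

text \<open>There are only countably many strings, so all null prefixes can be avoided at once. This
  carries bounds that hold on histories of positive probability over to almost every
  sequence.\<close>

lemma AE_prefix_prob_pos: "AE \<omega> in \<rho>. \<forall>n. prefix_prob \<rho> (stake n \<omega>) > 0"
proof -
  have "AE \<omega> in \<rho>. stake (length xs) \<omega> \<noteq> xs" if "\<not> prefix_prob \<rho> xs > 0" for xs
  proof (rule AE_I)
    show "emeasure \<rho> {\<omega> \<in> space \<rho>. stake (length xs) \<omega> = xs} = 0"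
      using that measure_nonneg[of \<rho> "{\<omega> \<in> space \<rho>. stake (length xs) \<omega> = xs}"]
      by (simp add: emeasure_eq_measure prefix_prob_def)
  qed auto
  then have "AE \<omega> in \<rho>. \<forall>xs. \<not> prefix_prob \<rho> xs > 0 \<longrightarrow> stake (length xs) \<omega> \<noteq> xs"
    by (subst AE_all_countable) auto
  then show ?thesis by eventually_elim (metis length_stake)
qed

text \<open>Over a finite alphabet a function of the first \<open>n\<close> symbols is a finite
  combination of cylinder indicators, hence integrable whatever \<open>g\<close> is.\<close>

lemma has_bochner_integral_stake:
  "has_bochner_integral \<rho> (\<lambda>\<omega>. g (stake n \<omega>)) (\<Sum>xs | length xs = n. prefix_prob \<rho> xs * g xs)"
  for g :: "'x list \<Rightarrow> real"
proof -
  let ?E = "\<lambda>xs. {\<omega> \<in> space \<rho>. stake n \<omega> = xs}"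
  have "has_bochner_integral \<rho> (\<lambda>\<omega>. \<Sum>xs | length xs = n. indicator (?E xs) \<omega> * g xs)
      (\<Sum>xs | length xs = n. prefix_prob \<rho> xs * g xs)"
  proof (intro has_bochner_integral_sum has_bochner_integral_mult_left)
    fix xs :: "'x list" assume "xs \<in> {xs. length xs = n}"
    then show "has_bochner_integral \<rho> (indicator (?E xs)) (prefix_prob \<rho> xs)"
      using has_bochner_integral_real_indicator[of "?E xs" \<rho>]
      by (auto simp: prefix_prob_def emeasure_eq_measure)
  qed
  moreover have "(\<Sum>xs | length xs = n. indicator (?E xs) \<omega> * g xs) = g (stake n \<omega>)"
    if "\<omega> \<in> space \<rho>" for \<omega>
  proof -
    have "(\<Sum>xs | length xs = n. indicator (?E xs) \<omega> * g xs)
        = (\<Sum>xs | length xs = n. if xs = stake n \<omega> then g xs else 0)"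
      using that by (intro sum.cong) auto
    then show ?thesis by (simp add: sum.delta finite_lists_of_length)
  qed
  ultimately show ?thesis by (subst has_bochner_integral_cong) auto
qed

lemma integrable_stake: "integrable \<rho> (\<lambda>\<omega>. g (stake n \<omega>))" for g :: "'x list \<Rightarrow> real"
  using has_bochner_integral_stake by (rule integrable.intros)

lemma integral_stake:
  "(\<integral>\<omega>. g (stake n \<omega>) \<partial>\<rho>) = (\<Sum>xs | length xs = n. prefix_prob \<rho> xs * g xs)"
  for g :: "'x list \<Rightarrow> real"
  using has_bochner_integral_stake by (rule has_bochner_integral_integral_eq)

end

section \<open>Mixtures: consistency and dominance\<close>

lemma has_sum_sum:
  fixes f :: "'b \<Rightarrow> 'a \<Rightarrow> 'c :: topological_comm_monoid_add"
  assumes "\<And>i. i \<in> I \<Longrightarrow> (f i has_sum s i) A"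
  shows "((\<lambda>x. \<Sum>i\<in>I. f i x) has_sum (\<Sum>i\<in>I. s i)) A"
  using assms by (induction I rule: infinite_finite_induct) (auto intro: has_sum_add)

context
  fixes \<M> :: "'x::finite stream measure set" and w :: "'x stream measure \<Rightarrow> real"
  assumes prob: "\<And>\<nu>. \<nu> \<in> \<M> \<Longrightarrow> prob_space \<nu>"
    and sets: "\<And>\<nu>. \<nu> \<in> \<M> \<Longrightarrow> sets \<nu> = sets (stream_space (count_space UNIV))"
    and w_pos: "\<And>\<nu>. \<nu> \<in> \<M> \<Longrightarrow> w \<nu> > 0"
    and sum_w: "(w has_sum 1) \<M>"
begin

text \<open>The series is dominated by the weights, so the \<open>infsum\<close> in
  \<open>mixture\<close> is a genuine sum and not the default 0.\<close>

lemma has_sum_mixture: "((\<lambda>\<nu>. w \<nu> * prefix_prob \<nu> xs) has_sum mixture \<M> w xs) \<M>"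
  unfolding mixture_def
proof (rule has_sum_infsum, rule summable_on_comparison_test)
  show "w summable_on \<M>" using sum_w by (rule has_sum_imp_summable)
  fix \<nu> assume \<nu>: "\<nu> \<in> \<M>"
  then show "w \<nu> * prefix_prob \<nu> xs \<le> w \<nu>"
    using w_pos[OF \<nu>] prefix_prob_le_1[OF prob[OF \<nu>] sets[OF \<nu>]] by (intro mult_left_le) auto
  show "0 \<le> w \<nu> * prefix_prob \<nu> xs"
    using w_pos[OF \<nu>] by (simp add: prefix_prob_def)
qed

text \<open>Consistency passes from the members to the mixture because finite sums commute with
  \<open>has_sum\<close>; uniqueness of the sum then yields the equations.\<close>

lemma string_distribution_mixture: "string_distribution (mixture \<M> w)"
  unfolding string_distribution_def
proof (intro conjI allI)
  have dist: "string_distribution (prefix_prob \<nu>)" if "\<nu> \<in> \<M>" for \<nu>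
    using that by (intro string_distribution_prefix_prob prob sets)
  have "(w has_sum mixture \<M> w []) \<M>"
    using has_sum_mixture[of "[]"] dist
    by (subst has_sum_cong[where g = "\<lambda>\<nu>. w \<nu> * prefix_prob \<nu> []"])
      (auto simp: string_distribution_def)
  then show "mixture \<M> w [] = 1" using sum_w by (rule has_sum_unique)
  fix xs
  show "0 \<le> mixture \<M> w xs"
    using w_pos unfolding mixture_def
    by (intro infsum_nonneg mult_nonneg_nonneg) (auto simp: prefix_prob_def less_imp_le)
  have "((\<lambda>\<nu>. \<Sum>a\<in>UNIV. w \<nu> * prefix_prob \<nu> (xs @ [a]))
      has_sum (\<Sum>a\<in>UNIV. mixture \<M> w (xs @ [a]))) \<M>"
    by (intro has_sum_sum has_sum_mixture)
  then have "((\<lambda>\<nu>. w \<nu> * prefix_prob \<nu> xs)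
      has_sum (\<Sum>a\<in>UNIV. mixture \<M> w (xs @ [a]))) \<M>"
    by (subst has_sum_cong[where g = "\<lambda>\<nu>. \<Sum>a\<in>UNIV. w \<nu> * prefix_prob \<nu> (xs @ [a])"])
      (use dist in \<open>auto simp: string_distribution_def simp flip: sum_distrib_left\<close>)
  then show "(\<Sum>a\<in>UNIV. mixture \<M> w (xs @ [a])) = mixture \<M> w xs"
    using has_sum_mixture by (rule has_sum_unique)
qed

text \<open>A single term of a nonnegative series is at most its sum. This dominance is the source
  of the bound on the total entropy and of the positivity of the mixture.\<close>

lemma mixture_ge:
  assumes "\<nu> \<in> \<M>"
  shows "w \<nu> * prefix_prob \<nu> xs \<le> mixture \<M> w xs"
  using finite_sum_le_has_sum[OF has_sum_mixture[of xs], of "{\<nu>}"] assms w_pos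
  by (auto simp: prefix_prob_def less_imp_le)

end

subsection \<open>Prediction schemes\<close>

context
  fixes loss :: "'x::finite \<Rightarrow> 'y \<Rightarrow> real" and p q :: "'x list \<Rightarrow> real"
    and \<Lambda>\<^sub>p \<Lambda>\<^sub>q :: "'x list \<Rightarrow> 'y" and xs :: "'x list"
  assumes loss: "\<And>x y. loss x y \<in> {0..1}"
    and p: "string_distribution p" and q: "string_distribution q"
    and ac: "\<And>xs. p xs > 0 \<Longrightarrow> q xs > 0"
    and \<Lambda>\<^sub>p: "is_prediction_scheme loss p \<Lambda>\<^sub>p" and \<Lambda>\<^sub>q: "is_prediction_scheme loss q \<Lambda>\<^sub>q"
    and xs: "p xs > 0"
begin

lemma next_prob_pos: "next_prob p xs a > 0 \<Longrightarrow> next_prob q xs a > 0"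
  using ac[OF xs] ac[of "xs @ [a]"] xs by (simp add: next_prob_def zero_less_divide_iff)

text \<open>These discharge, in order, the assumptions on \<open>p\<close> and \<open>q\<close> of
  the inequalities for two probability vectors.\<close>

lemmas next_prob_facts = next_prob_nonneg[OF p] next_prob_nonneg[OF q]
  next_prob_pos sum_next_prob[OF p xs] sum_next_prob[OF q ac[OF xs]]

lemma rel_entropy_nonneg: "0 \<le> rel_entropy p q xs"
  unfolding rel_entropy_def by (rule Gibbs_inequality[OF next_prob_facts])

lemma total_variation_le_sqrt_rel_entropy:
  "(\<Sum>a\<in>UNIV. \<bar>next_prob q xs a - next_prob p xs a\<bar>) \<le> sqrt (2 * rel_entropy p q xs)"
  unfolding rel_entropy_def by (rule Pinsker_inequality[OF next_prob_facts])

lemma expected_loss_bounds: "expected_loss loss p xs y \<in> {0..1}"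
proof -
  have "expected_loss loss p xs y \<le> (\<Sum>a\<in>UNIV. next_prob p xs a)"
    unfolding expected_loss_def
    using loss next_prob_nonneg[OF p] by (intro sum_mono mult_left_le) auto
  moreover have "0 \<le> expected_loss loss p xs y"
    unfolding expected_loss_def
    using loss next_prob_nonneg[OF p] by (intro sum_nonneg mult_nonneg_nonneg) auto
  ultimately show ?thesis by (simp add: sum_next_prob[OF p xs])
qed

lemma scheme_loss_ge: "expected_loss loss p xs (\<Lambda>\<^sub>p xs) \<le> expected_loss loss p xs (\<Lambda>\<^sub>q xs)"
  using \<Lambda>\<^sub>p xs by (simp add: is_prediction_scheme_def is_arg_min_linorder)

lemma scheme_loss_le_under_model:
  "(\<Sum>a\<in>UNIV. next_prob q xs a * loss a (\<Lambda>\<^sub>q xs))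
    \<le> (\<Sum>a\<in>UNIV. next_prob q xs a * loss a (\<Lambda>\<^sub>p xs))"
  using \<Lambda>\<^sub>q ac[OF xs] unfolding is_prediction_scheme_def is_arg_min_linorder expected_loss_def
  by blast

lemma scheme_loss_gap_le_total_variation:
  "expected_loss loss p xs (\<Lambda>\<^sub>q xs) - expected_loss loss p xs (\<Lambda>\<^sub>p xs)
    \<le> (\<Sum>a\<in>UNIV. \<bar>next_prob q xs a - next_prob p xs a\<bar>)"
  unfolding expected_loss_def
  by (rule loss_gap_le_total_variation[OF next_prob_facts loss loss scheme_loss_le_under_model])

lemma scheme_loss_gap_le_rel_entropy:
  "expected_loss loss p xs (\<Lambda>\<^sub>q xs) - expected_loss loss p xs (\<Lambda>\<^sub>p xs)
    \<le> 2 * rel_entropy p q xs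
      + 2 * sqrt (expected_loss loss p xs (\<Lambda>\<^sub>p xs) * rel_entropy p q xs)"
  unfolding expected_loss_def rel_entropy_def
  by (rule loss_gap_bound[OF next_prob_facts loss loss scheme_loss_le_under_model])

lemma scheme_loss_gap_squared_le:
  "(expected_loss loss p xs (\<Lambda>\<^sub>q xs) - expected_loss loss p xs (\<Lambda>\<^sub>p xs))\<^sup>2
    \<le> 2 * rel_entropy p q xs"
proof -
  \<comment> \<open>Squaring preserves the bound because \<open>scheme_loss_ge\<close> makes the gap
    nonnegative.\<close>
  have "(expected_loss loss p xs (\<Lambda>\<^sub>q xs) - expected_loss loss p xs (\<Lambda>\<^sub>p xs))\<^sup>2
      \<le> (sqrt (2 * rel_entropy p q xs))\<^sup>2"
    using scheme_loss_ge scheme_loss_gap_le_total_variation total_variation_le_sqrt_rel_entropy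
    by (intro power_mono) auto
  then show ?thesis using rel_entropy_nonneg by simp
qed

end


section \<open>Bounds in expectation, bounds per history, and limits along almost every
  sequence\<close>

theorem theorem4:
  fixes \<M> :: "'x::finite stream measure set"
    and \<mu> :: "'x stream measure"
    and w :: "'x stream measure \<Rightarrow> real"
    and loss :: "'x \<Rightarrow> 'y \<Rightarrow> real"
    and \<Lambda>\<^sub>\<mu> \<Lambda>\<^sub>\<xi> :: "'x list \<Rightarrow> 'y"
  assumes "countable \<M>"
    and "\<And>\<nu>. \<nu> \<in> \<M> \<Longrightarrow> prob_space \<nu>"
    and "\<And>\<nu>. \<nu> \<in> \<M> \<Longrightarrow> sets \<nu> = sets (stream_space (count_space UNIV))"
    and "\<mu> \<in> \<M>"
    and "\<And>\<nu>. \<nu> \<in> \<M> \<Longrightarrow> w \<nu> > 0"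
    and "(w has_sum 1) \<M>"
    and "\<And>x y. loss x y \<in> {0..1}"
    and "is_prediction_scheme loss (prefix_prob \<mu>) \<Lambda>\<^sub>\<mu>"
    and "is_prediction_scheme loss (mixture \<M> w) \<Lambda>\<^sub>\<xi>"
  shows
    "let \<xi> = mixture \<M> w;
         l\<^sub>\<mu> = inst_loss loss \<mu> \<Lambda>\<^sub>\<mu>;
         l\<^sub>\<xi> = inst_loss loss \<mu> \<Lambda>\<^sub>\<xi>;
         d = rel_entropy (prefix_prob \<mu>) \<xi>;
         D = total_rel_entropy \<mu> \<xi>
     in
       (\<forall>n\<ge>1.
          (\<Sum>t=1..n. \<integral>\<omega>. (l\<^sub>\<xi> (stake (t - 1) \<omega>) - l\<^sub>\<mu> (stake (t - 1) \<omega>))\<^sup>2 \<partial>\<mu>) \<le> 2 * D n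
          \<and> 2 * D n \<le> 2 * ln (inverse (w \<mu>))
          \<and> ereal (2 * ln (inverse (w \<mu>))) < \<infinity>)
     \<and> (\<forall>xs. prefix_prob \<mu> xs > 0 \<longrightarrow>
          0 \<le> l\<^sub>\<xi> xs - l\<^sub>\<mu> xs
          \<and> l\<^sub>\<xi> xs - l\<^sub>\<mu> xs
              \<le> (\<Sum>a\<in>UNIV. \<bar>next_prob \<xi> xs a - next_prob (prefix_prob \<mu>) xs a\<bar>)
          \<and> (\<Sum>a\<in>UNIV. \<bar>next_prob \<xi> xs a - next_prob (prefix_prob \<mu>) xs a\<bar>)
              \<le> sqrt (2 * d xs))
     \<and> (AE \<omega> in \<mu>. (\<lambda>t. sqrt (2 * d (stake (t - 1) \<omega>))) \<longlonglongrightarrow> 0)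
     \<and> (\<forall>xs. prefix_prob \<mu> xs > 0 \<longrightarrow>
          0 \<le> l\<^sub>\<xi> xs - l\<^sub>\<mu> xs
          \<and> l\<^sub>\<xi> xs - l\<^sub>\<mu> xs \<le> 2 * d xs + 2 * sqrt (l\<^sub>\<mu> xs * d xs))
     \<and> (AE \<omega> in \<mu>. (\<lambda>t. 2 * d (stake (t - 1) \<omega>)
            + 2 * sqrt (l\<^sub>\<mu> (stake (t - 1) \<omega>) * d (stake (t - 1) \<omega>))) \<longlonglongrightarrow> 0)"
proof -
  define \<xi> where "\<xi> = mixture \<M> w"
  define P where "P = prefix_prob \<mu>"
  define d where "d = rel_entropy P \<xi>"
  define l where "l \<Lambda> xs = expected_loss loss P xs (\<Lambda> xs)" for \<Lambda> :: "'x list \<Rightarrow> 'y" and xs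
  note \<mu> = assms(2)[OF assms(4)] assms(3)[OF assms(4)]
  have w: "w \<mu> > 0" by (rule assms(5)[OF assms(4)])
  have P: "string_distribution P"
    unfolding P_def by (rule string_distribution_prefix_prob[OF \<mu>])
  have \<xi>: "string_distribution \<xi>"
    unfolding \<xi>_def by (rule string_distribution_mixture[OF assms(2,3,5,6)])
  have \<xi>_ge: "w \<mu> * P xs \<le> \<xi> xs" for xs
    unfolding \<xi>_def P_def by (rule mixture_ge[OF assms(2,3,5,6,4)])
  have ac: "\<xi> xs > 0" if "P xs > 0" for xs
    using \<xi>_ge[of xs] mult_pos_pos[OF w that] by linarith
  note scheme_facts = assms(7) P \<xi> ac assms(8)[folded P_def] assms(9)[folded \<xi>_def]
  have d_nonneg: "0 \<le> d xs" if "P xs > 0" for xs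
    unfolding d_def by (rule rel_entropy_nonneg[OF scheme_facts that])
  have gap_squared: "(l \<Lambda>\<^sub>\<xi> xs - l \<Lambda>\<^sub>\<mu> xs)\<^sup>2 \<le> 2 * d xs" if "P xs > 0" for xs
    unfolding l_def d_def by (rule scheme_loss_gap_squared_le[OF scheme_facts that])
  have l_bounds: "l \<Lambda>\<^sub>\<mu> xs \<in> {0..1}" if "P xs > 0" for xs
    unfolding l_def by (rule expected_loss_bounds[OF scheme_facts that])
  have AE_pos: "AE \<omega> in \<mu>. \<forall>n. P (stake n \<omega>) > 0"
    unfolding P_def by (rule AE_prefix_prob_pos[OF \<mu>])

  have sum_d_le: "(\<Sum>t<n. \<integral>\<omega>. d (stake t \<omega>) \<partial>\<mu>) \<le> ln (inverse (w \<mu>))" for n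
    unfolding integral_stake[OF \<mu>] d_def P_def[symmetric]
    by (rule sum_rel_entropy_le[OF P \<xi> w \<xi>_ge])
  \<comment> \<open>Time \<open>t\<close> sees a history of length \<open>t - 1\<close>, so the
    range \<open>1..n\<close> of times becomes the range \<open>t < n\<close> of lengths.\<close>
  have D_eq: "total_rel_entropy \<mu> \<xi> n = (\<Sum>t<n. \<integral>\<omega>. d (stake t \<omega>) \<partial>\<mu>)" for n
    unfolding total_rel_entropy_def d_def P_def
    by (rule sum.reindex_bij_witness[of _ Suc "\<lambda>t. t - 1"]) auto
  have squares: "(\<Sum>t=1..n. \<integral>\<omega>. (l \<Lambda>\<^sub>\<xi> (stake (t - 1) \<omega>) - l \<Lambda>\<^sub>\<mu> (stake (t - 1) \<omega>))\<^sup>2 \<partial>\<mu>)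
      \<le> 2 * total_rel_entropy \<mu> \<xi> n" for n
  proof -
    \<comment> \<open>The comparison is only almost sure, since \<open>gap_squared\<close> speaks of
      histories of positive probability.\<close>
    have "(\<integral>\<omega>. (l \<Lambda>\<^sub>\<xi> (stake t \<omega>) - l \<Lambda>\<^sub>\<mu> (stake t \<omega>))\<^sup>2 \<partial>\<mu>) \<le> (\<integral>\<omega>. 2 * d (stake t \<omega>) \<partial>\<mu>)" for t
    proof (rule integral_mono_AE)
      show "AE \<omega> in \<mu>. (l \<Lambda>\<^sub>\<xi> (stake t \<omega>) - l \<Lambda>\<^sub>\<mu> (stake t \<omega>))\<^sup>2 \<le> 2 * d (stake t \<omega>)"
        using AE_pos by eventually_elim (simp add: gap_squared)
    qed (rule integrable_stake[OF \<mu>])+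
    then show ?thesis
      unfolding total_rel_entropy_def sum_distrib_left d_def P_def
      by (intro sum_mono) simp
  qed

  have AE_d: "AE \<omega> in \<mu>. (\<lambda>t. d (stake t \<omega>)) \<longlonglongrightarrow> 0"
  proof (rule AE_tendsto_0_if_sum_integral_bounded[OF _ _ sum_d_le])
    show "AE \<omega> in \<mu>. 0 \<le> d (stake n \<omega>)" for n
      using AE_pos by eventually_elim (auto intro: d_nonneg)
  qed (rule integrable_stake[OF \<mu>])
  \<comment> \<open>At \<open>t = 0\<close> truncated subtraction repeats the value at time 1, which
    does not affect the limit.\<close>
  have shift: "(\<lambda>t. f (t - 1)) \<longlonglongrightarrow> 0" if "f \<longlonglongrightarrow> 0" for f :: "nat \<Rightarrow> real"
    using that by (subst filterlim_sequentially_Suc[symmetric]) simp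
  have AE_sqrt: "AE \<omega> in \<mu>. (\<lambda>t. sqrt (2 * d (stake (t - 1) \<omega>))) \<longlonglongrightarrow> 0"
    using AE_d
  proof eventually_elim
    case (elim \<omega>)
    then have "(\<lambda>t. sqrt (2 * d (stake t \<omega>))) \<longlonglongrightarrow> sqrt (2 * 0)"
      by (intro tendsto_intros)
    then show ?case
      by (intro shift[of "\<lambda>t. sqrt (2 * d (stake t \<omega>))"]) simp
  qed
  have AE_bound: "AE \<omega> in \<mu>. (\<lambda>t. 2 * d (stake (t - 1) \<omega>)
      + 2 * sqrt (l \<Lambda>\<^sub>\<mu> (stake (t - 1) \<omega>) * d (stake (t - 1) \<omega>))) \<longlonglongrightarrow> 0"
    using AE_d AE_pos
  proof eventually_elim
    case (elim \<omega>)
    \<comment> \<open>As the loss lies in the unit interval, the product is squeezed between 0 and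
      the entropy.\<close>
    have "(\<lambda>t. l \<Lambda>\<^sub>\<mu> (stake t \<omega>) * d (stake t \<omega>)) \<longlonglongrightarrow> 0"
    proof (rule tendsto_sandwich[OF _ _ tendsto_const elim(1)])
      have l: "l \<Lambda>\<^sub>\<mu> (stake t \<omega>) \<in> {0..1}" for t
        using elim(2) by (intro l_bounds) blast
      have d: "0 \<le> d (stake t \<omega>)" for t
        using elim(2) by (intro d_nonneg) blast
      show "\<forall>\<^sub>F t in sequentially. 0 \<le> l \<Lambda>\<^sub>\<mu> (stake t \<omega>) * d (stake t \<omega>)"
        using l d by (intro always_eventually allI mult_nonneg_nonneg) auto
      show "\<forall>\<^sub>F t in sequentially. l \<Lambda>\<^sub>\<mu> (stake t \<omega>) * d (stake t \<omega>) \<le> d (stake t \<omega>)"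
        using l d by (intro always_eventually allI mult_left_le_one_le) auto
    qed
    with elim(1) have "(\<lambda>t. 2 * d (stake t \<omega>)
        + 2 * sqrt (l \<Lambda>\<^sub>\<mu> (stake t \<omega>) * d (stake t \<omega>))) \<longlonglongrightarrow> 2 * 0 + 2 * sqrt 0"
      by (intro tendsto_add tendsto_mult tendsto_real_sqrt tendsto_const)
    then show ?case
      by (intro shift[of "\<lambda>t. 2 * d (stake t \<omega>) + 2 * sqrt (l \<Lambda>\<^sub>\<mu> (stake t \<omega>) * d (stake t \<omega>))"]) simp
  qed

  have inst: "inst_loss loss \<mu> \<Lambda> = l \<Lambda>" for \<Lambda>
    by (simp add: fun_eq_iff inst_loss_def l_def P_def)
  show ?thesis
    unfolding Let_def inst \<xi>_def[symmetric] P_def[symmetric] d_def[symmetric]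
  proof (intro conjI allI impI)
    show "2 * total_rel_entropy \<mu> \<xi> n \<le> 2 * ln (inverse (w \<mu>))" for n
      using sum_d_le[of n] by (simp add: D_eq)
    fix xs assume xs: "P xs > 0"
    show "0 \<le> l \<Lambda>\<^sub>\<xi> xs - l \<Lambda>\<^sub>\<mu> xs" "0 \<le> l \<Lambda>\<^sub>\<xi> xs - l \<Lambda>\<^sub>\<mu> xs"
      using scheme_loss_ge[OF scheme_facts xs] by (simp_all add: l_def)
    show "l \<Lambda>\<^sub>\<xi> xs - l \<Lambda>\<^sub>\<mu> xs \<le> (\<Sum>a\<in>UNIV. \<bar>next_prob \<xi> xs a - next_prob P xs a\<bar>)"
      unfolding l_def by (rule scheme_loss_gap_le_total_variation[OF scheme_facts xs])
    show "(\<Sum>a\<in>UNIV. \<bar>next_prob \<xi> xs a - next_prob P xs a\<bar>) \<le> sqrt (2 * d xs)"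
      unfolding d_def by (rule total_variation_le_sqrt_rel_entropy[OF scheme_facts xs])
    show "l \<Lambda>\<^sub>\<xi> xs - l \<Lambda>\<^sub>\<mu> xs \<le> 2 * d xs + 2 * sqrt (l \<Lambda>\<^sub>\<mu> xs * d xs)"
      unfolding l_def d_def by (rule scheme_loss_gap_le_rel_entropy[OF scheme_facts xs])
  qed (rule squares, simp, rule AE_sqrt, rule AE_bound)
qed

end
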